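(* Let $A,B,C$ be real symmetric positive semidefinite $n\times n$ matrices with $A,B\neq 0$. Let $w=(a,b)$ with $a,b>0$ and $a+b=1$. Let $p\in[-\infty,1)$ and $q=p(p-1)^{-1}$ (with $q=1$ if $p=-\infty$). For $p\ne 0$ define $I_p=[0,1]$ if $p<0$ and $I_p=(0,1)$ if $0<p<1$. Consider the statements: (i) For all $x\in\mathbb{R}^n$, $\operatorname{Mean}_{p,w}\bigl[x^\top Ax,\;x^\top Bx\bigr]\le x^\top Cx$. (ii) There exists $s>0$ such that $a\,s^{b}A+b\,s^{-a}B\preceq C$. (iii) There exists $s\in I_p$ such that $a^{1/p}s^{1/q}A+b^{1/p}(1-s)^{1/q}B\preceq C$. If $p=0$, then (i) $\Leftrightarrow$ (ii). If $p\neq 0$, then (i) $\Leftrightarrow$ (iii).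
   Context: Weighted power means: for $y\in\mathbb{R}^m_{\ge 0}$, weights $w\in\mathbb{R}^m_{>0}$ with $\sum_i w_i=1$, and real $p\ne 0$, $\operatorname{Mean}_{p,w}[y]=\bigl(\sum_{i=1}^m w_i y_i^p\bigr)^{1/p}$, with the convention that $\operatorname{Mean}_{p,w}[y]=0$ if $p<0$ and some $y_i=0$. In the limiting cases, $\operatorname{Mean}_{0,w}[y]=\prod_{i=1}^m y_i^{w_i}$ and $\operatorname{Mean}_{-\infty,w}[y]=\min_i y_i$. For $p=-\infty$ one reads $1/p=0$ (and $q=1$). $\preceq$ denotes the Loewner order on symmetric matrices. *)

theory Defs
  imports "HOL-Analysis.Analysis"
begin

text \<open>Real symmetric positive semidefinite matrices and the Loewner order. Symmetry is part of
  \<open>psd\<close>; for symmetric \<open>A\<close> and \<open>B\<close> it holds automatically for \<open>B - A\<close>.\<close>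

definition psd :: "real ^ 'n ^ 'n \<Rightarrow> bool" where
  "psd A \<longleftrightarrow> transpose A = A \<and> (\<forall>x. 0 \<le> x \<bullet> (A *v x))"

definition loewner_le :: "real ^ 'n ^ 'n \<Rightarrow> real ^ 'n ^ 'n \<Rightarrow> bool" (infix "\<preceq>\<^sub>L" 50) where
  "A \<preceq>\<^sub>L B \<longleftrightarrow> psd (B - A)"

text \<open>The weighted power mean of exponent \<open>p \<in> [-\<infinity>, \<infinity>)\<close>, meant for nonnegative \<open>y\<close> and positive
  weights \<open>w\<close> of sum 1. Since \<open>0 powr r = 0\<close> for every \<open>r\<close>, the vanishing of the mean
  when \<open>p < 0\<close> and some \<open>y $ i = 0\<close> has to be stipulated; for \<open>p \<ge> 0\<close> the formulas already
  take the right value when some \<open>y $ i = 0\<close>. The value at \<open>p = \<infinity>\<close> is irrelevant.\<close>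

definition power_mean :: "ereal \<Rightarrow> real ^ 'm \<Rightarrow> real ^ 'm \<Rightarrow> real" where
  "power_mean p w y =
     (if p = -\<infinity> then Min (range (\<lambda>i. y $ i))
      else if p = 0 then (\<Prod>i\<in>UNIV. (y $ i) powr (w $ i))
      else if p < 0 \<and> (\<exists>i. y $ i = 0) then 0
      else (\<Sum>i\<in>UNIV. w $ i * (y $ i) powr real_of_ereal p) powr (1 / real_of_ereal p))"

text \<open>The exponents \<open>1/p\<close> and \<open>q = p (p - 1)\<^sup>-\<^sup>1\<close>, with \<open>1/p = 0\<close> and \<open>q = 1\<close> at \<open>p = -\<infinity>\<close>.\<close>

definition recip_exponent :: "ereal \<Rightarrow> real" where
  "recip_exponent p = (if p = -\<infinity> then 0 else 1 / real_of_ereal p)"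

definition conj_exponent :: "ereal \<Rightarrow> real" where
  "conj_exponent p = (if p = -\<infinity> then 1 else real_of_ereal p * inverse (real_of_ereal p - 1))"

text \<open>The parameter set \<open>I\<^sub>p\<close>, meant for \<open>p < 1\<close> and \<open>p \<noteq> 0\<close>.\<close>

definition param_set :: "ereal \<Rightarrow> real set" where
  "param_set p = (if p < 0 then {0..1} else {0<..<1})"

end

theory Submission
  imports Defs "HOL-Real_Asymp.Real_Asymp"
begin

text \<open>The mean of \<open>(y, z)\<close> is the minimum (for \<open>p \<ge> 0\<close> the infimum) over the parameter \<open>s\<close> of a linear
  form \<open>\<alpha>(s) y + \<beta>(s) z\<close>, attained where \<open>\<mu>(s) y = \<nu>(s) z\<close>; this gives the easy direction.
  Conversely, suppose that every \<open>s\<close> admits an \<open>x\<close> at which \<open>H = \<alpha>(s) A + \<beta>(s) B - C\<close> is positive.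
  By (i), \<open>M = \<mu>(s) A - \<nu>(s) B\<close> does not vanish at such an \<open>x\<close>, and it cannot take both signs for
  the same \<open>s\<close>: on the plane spanned by two such vectors \<open>M\<close> would have an isotropic vector
  at which \<open>H\<close> is positive. So the sign of \<open>M\<close> splits the parameter interval into two disjoint
  open sets. Both are nonempty, as the behaviour at the two endpoints shows, which contradicts
  connectedness.\<close>

section \<open>Quadratic forms and the Loewner order\<close>

lemma quadform_add_scaleR:
  fixes D :: "real ^ 'n ^ 'n"
  shows "(x + t *\<^sub>R y) \<bullet> (D *v (x + t *\<^sub>R y))
    = x \<bullet> (D *v x) + t * (x \<bullet> (D *v y) + y \<bullet> (D *v x)) + t\<^sup>2 * (y \<bullet> (D *v y))"
  by (simp add: matrix_vector_right_distrib matrix_vector_mult_scaleR inner_add_left inner_add_right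
      algebra_simps power2_eq_square)

text \<open>The roots have product \<open>c / d < 0\<close>, so one of them is positive; the
  quadratic formula names it.\<close>

lemma quadratic_pos_root:
  fixes c m d :: real
  assumes "c > 0" "d < 0"
  obtains t where "t > 0" "c + t * m + t\<^sup>2 * d = 0"
proof -
  define R where "R = sqrt (m\<^sup>2 - 4 * c * d)"
  have cd: "c * d < 0" using assms by (simp add: mult_pos_neg)
  have R2: "R\<^sup>2 = m\<^sup>2 - 4 * c * d"
    unfolding R_def using cd zero_le_power2[of m] by (subst real_sqrt_pow2) linarith+
  have "\<bar>m\<bar> < R"
    unfolding R_def using cd by (intro real_less_rsqrt) auto
  then have "m + R > 0" by linarith
  show thesis
  proof (rule that[of "(m + R) / (- 2 * d)"])
    show "(m + R) / (- 2 * d) > 0" using \<open>m + R > 0\<close> assms by (intro divide_pos_pos) auto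
    have "c + (m + R) / (- 2 * d) * m + ((m + R) / (- 2 * d))\<^sup>2 * d = (4 * c * d + R\<^sup>2 - m\<^sup>2) / (4 * d)"
      using assms by (simp add: field_simps power2_eq_square)
    then show "c + (m + R) / (- 2 * d) * m + ((m + R) / (- 2 * d))\<^sup>2 * d = 0"
      by (simp add: R2)
  qed
qed

text \<open>On a ray \<open>x + t v\<close> with \<open>t > 0\<close> the form of \<open>M\<close>
  starts positive and ends negative, hence vanishes somewhere. The form of \<open>H\<close> stays
  positive along the whole ray as soon as its cross term is nonnegative.\<close>

lemma isotropic_vector_with_pos_value:
  fixes H M :: "real ^ 'n ^ 'n"
  assumes "x \<bullet> (H *v x) > 0" "y \<bullet> (H *v y) > 0" "x \<bullet> (M *v x) > 0" "y \<bullet> (M *v y) < 0"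
  obtains z where "z \<bullet> (M *v z) = 0" "z \<bullet> (H *v z) > 0"
proof -
  have *: "\<exists>z. z \<bullet> (M *v z) = 0 \<and> z \<bullet> (H *v z) > 0" if cross: "x \<bullet> (H *v v) + v \<bullet> (H *v x) \<ge> 0"
    and v: "v \<bullet> (H *v v) > 0" "v \<bullet> (M *v v) < 0" for v
  proof -
    obtain t where t: "t > 0"
      "x \<bullet> (M *v x) + t * (x \<bullet> (M *v v) + v \<bullet> (M *v x)) + t\<^sup>2 * (v \<bullet> (M *v v)) = 0"
      using quadratic_pos_root[OF assms(3) v(2)] by blast
    show ?thesis
    proof (intro exI conjI)
      show "(x + t *\<^sub>R v) \<bullet> (M *v (x + t *\<^sub>R v)) = 0"
        using t by (simp add: quadform_add_scaleR)
      show "(x + t *\<^sub>R v) \<bullet> (H *v (x + t *\<^sub>R v)) > 0"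
        unfolding quadform_add_scaleR using t cross v assms(1)
        by (intro add_pos_nonneg) auto
    qed
  qed
  show thesis
  proof (cases "x \<bullet> (H *v y) + y \<bullet> (H *v x) \<ge> 0")
    case True
    then show ?thesis using * assms that by blast
  next
    case False
    \<comment> \<open>Replacing \<open>y\<close> by \<open>- y\<close> flips the sign of the cross
      term and leaves the values of both forms unchanged.\<close>
    have neg: "D *v (- y) = - (D *v y)" for D :: "real ^ 'n ^ 'n"
      using matrix_vector_mult_scaleR[of D "-1" y] by simp
    obtain z where "z \<bullet> (M *v z) = 0" "z \<bullet> (H *v z) > 0"
      using *[of "- y"] False assms by (auto simp: neg)
    then show ?thesis by (rule that)
  qed
qed

lemma quadform_lincomb:
  fixes A B C :: "real ^ 'n ^ 'n"
  shows "x \<bullet> ((u *\<^sub>R A + v *\<^sub>R B) *v x) = u * (x \<bullet> (A *v x)) + v * (x \<bullet> (B *v x))"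
    and "x \<bullet> ((u *\<^sub>R A - v *\<^sub>R B) *v x) = u * (x \<bullet> (A *v x)) - v * (x \<bullet> (B *v x))"
    and "x \<bullet> ((u *\<^sub>R A + v *\<^sub>R B - C) *v x)
      = u * (x \<bullet> (A *v x)) + v * (x \<bullet> (B *v x)) - x \<bullet> (C *v x)"
  by (simp_all add: matrix_vector_mult_add_rdistrib matrix_vector_mult_diff_rdistrib
      scaleR_matrix_vector_assoc[symmetric] inner_add_right inner_diff_right)

text \<open>Symmetry of the difference is automatic here, so the Loewner order reduces to a
  pointwise comparison of forms.\<close>

lemma loewner_le_lincomb_iff:
  fixes A B C :: "real ^ 'n ^ 'n"
  assumes "psd A" "psd B" "psd C"
  shows "u *\<^sub>R A + v *\<^sub>R B \<preceq>\<^sub>L C \<longleftrightarrow>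
    (\<forall>x. u * (x \<bullet> (A *v x)) + v * (x \<bullet> (B *v x)) \<le> x \<bullet> (C *v x))"
proof -
  have "transpose (C - (u *\<^sub>R A + v *\<^sub>R B)) = C - (u *\<^sub>R A + v *\<^sub>R B)"
    using assms by (simp add: psd_def transpose_def vec_eq_iff)
  moreover have "x \<bullet> ((C - (u *\<^sub>R A + v *\<^sub>R B)) *v x)
      = x \<bullet> (C *v x) - (u * (x \<bullet> (A *v x)) + v * (x \<bullet> (B *v x)))" for x
    by (simp add: matrix_vector_mult_diff_rdistrib inner_diff_right quadform_lincomb)
  ultimately show ?thesis by (simp add: loewner_le_def psd_def)
qed

lemma psd_nonzero_pos:
  fixes A :: "real ^ 'n ^ 'n"
  assumes "psd A" "A \<noteq> 0"
  obtains x where "x \<bullet> (A *v x) > 0"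
proof (rule ccontr)
  assume "\<not> thesis"
  with that have "x \<bullet> (A *v x) \<le> 0" for x by (meson not_le)
  with assms have q: "x \<bullet> (A *v x) = 0" for x by (metis antisym psd_def)
  \<comment> \<open>Polarization: at \<open>u + v\<close> only the cross terms survive, and symmetry
    of \<open>A\<close> makes the two equal.\<close>
  have "u \<bullet> (A *v v) + v \<bullet> (A *v u) = 0" for u v
    using quadform_add_scaleR[of u 1 v A] q by simp
  moreover have "v \<bullet> (A *v u) = u \<bullet> (A *v v)" for u v
    using assms(1) by (metis dot_lmul_matrix inner_commute psd_def transpose_matrix_vector)
  ultimately have "u \<bullet> (A *v v) = 0" for u v by (metis mult_2 mult_eq_0_iff zero_neq_numeral)
  then have "A *v v = 0" for v using inner_eq_zero_iff by blast
  then show False using assms(2) by (metis matrix_eq matrix_vector_mult_0)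
qed

section \<open>The connectedness argument\<close>

text \<open>The coefficients are left abstract so that \<open>p = 0\<close>, with parameters in
  \<open>{0<..}\<close>, and \<open>p \<noteq> 0\<close>, with parameters in
  \<open>{0<..<1}\<close>, are both instances. The last two assumptions say that neither of the two
  open sets is empty.\<close>

lemma exists_dominating_parameter:
  fixes A B C :: "real ^ 'n ^ 'n" and \<alpha> \<beta> \<mu> \<nu> :: "real \<Rightarrow> real"
  assumes "connected S" and cont: "continuous_on S \<alpha>" "continuous_on S \<beta>"
      "continuous_on S \<mu>" "continuous_on S \<nu>"
    and balanced: "\<And>s x. \<lbrakk>s \<in> S; \<mu> s * (x \<bullet> (A *v x)) = \<nu> s * (x \<bullet> (B *v x))\<rbrakk>
      \<Longrightarrow> \<alpha> s * (x \<bullet> (A *v x)) + \<beta> s * (x \<bullet> (B *v x)) \<le> x \<bullet> (C *v x)"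
    and "\<exists>s\<in>S. \<exists>x. \<alpha> s * (x \<bullet> (A *v x)) + \<beta> s * (x \<bullet> (B *v x)) > x \<bullet> (C *v x)
      \<and> \<mu> s * (x \<bullet> (A *v x)) > \<nu> s * (x \<bullet> (B *v x))"
    and "\<exists>s\<in>S. \<exists>x. \<alpha> s * (x \<bullet> (A *v x)) + \<beta> s * (x \<bullet> (B *v x)) > x \<bullet> (C *v x)
      \<and> \<mu> s * (x \<bullet> (A *v x)) < \<nu> s * (x \<bullet> (B *v x))"
  shows "\<exists>s\<in>S. \<forall>x. \<alpha> s * (x \<bullet> (A *v x)) + \<beta> s * (x \<bullet> (B *v x)) \<le> x \<bullet> (C *v x)"
proof (rule ccontr)
  assume none: "\<not> ?thesis"
  define h where "h s x = \<alpha> s * (x \<bullet> (A *v x)) + \<beta> s * (x \<bullet> (B *v x)) - x \<bullet> (C *v x)" for s x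
  define m where "m s x = \<mu> s * (x \<bullet> (A *v x)) - \<nu> s * (x \<bullet> (B *v x))" for s x
  define L where "L = (\<Union>x. {s\<in>S. h s x > 0 \<and> m s x > 0})"
  define R where "R = (\<Union>x. {s\<in>S. h s x > 0 \<and> m s x < 0})"
  have [continuous_intros]: "continuous_on S (\<lambda>s. h s x)" "continuous_on S (\<lambda>s. m s x)" for x
    unfolding h_def m_def by (intro continuous_intros cont)+
  have "openin (top_of_set S) {s\<in>S. h s x > 0 \<and> m s x > 0}"
    "openin (top_of_set S) {s\<in>S. h s x > 0 \<and> m s x < 0}" for x
  proof -
    \<comment> \<open>For fixed \<open>x\<close> both \<open>h\<close> and \<open>m\<close> are
      continuous in \<open>s\<close>, so strict sign conditions define preimages of open
      quadrants.\<close>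
    have "openin (top_of_set S) (S \<inter> (\<lambda>s. (h s x, m s x)) -` ({0<..} \<times> {0<..}))"
      "openin (top_of_set S) (S \<inter> (\<lambda>s. (h s x, m s x)) -` ({0<..} \<times> {..<0}))"
      by (intro continuous_openin_preimage_gen continuous_intros open_Times open_greaterThan open_lessThan)+
    moreover have "S \<inter> (\<lambda>s. (h s x, m s x)) -` ({0<..} \<times> {0<..}) = {s\<in>S. h s x > 0 \<and> m s x > 0}"
      "S \<inter> (\<lambda>s. (h s x, m s x)) -` ({0<..} \<times> {..<0}) = {s\<in>S. h s x > 0 \<and> m s x < 0}"
      by auto
    ultimately show "openin (top_of_set S) {s\<in>S. h s x > 0 \<and> m s x > 0}"
      "openin (top_of_set S) {s\<in>S. h s x > 0 \<and> m s x < 0}" by simp_all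
  qed
  then have "openin (top_of_set S) L" "openin (top_of_set S) R"
    unfolding L_def R_def by blast+
  moreover have "S \<subseteq> L \<union> R"
  proof
    fix s assume s: "s \<in> S"
    with none obtain x where x: "h s x > 0" unfolding h_def by (metis diff_gt_0_iff_gt not_le)
    then have "m s x \<noteq> 0" using balanced[OF s, of x] unfolding h_def m_def by linarith
    then show "s \<in> L \<union> R" using s x unfolding L_def R_def by (auto simp: neq_iff)
  qed
  moreover have "L \<inter> R = {}"
  proof (rule ccontr)
    assume "L \<inter> R \<noteq> {}"
    then obtain s x y where s: "s \<in> S" and xy: "h s x > 0" "m s x > 0" "h s y > 0" "m s y < 0"
      unfolding L_def R_def by auto
    obtain z where "m s z = 0" "h s z > 0"
      using isotropic_vector_with_pos_value[of x "\<alpha> s *\<^sub>R A + \<beta> s *\<^sub>R B - C" y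
          "\<mu> s *\<^sub>R A - \<nu> s *\<^sub>R B"] xy
      unfolding h_def m_def quadform_lincomb by metis
    then show False using balanced[OF s, of z] unfolding h_def m_def by linarith
  qed
  moreover have "L \<noteq> {}" "R \<noteq> {}"
    using assms(7,8) unfolding L_def R_def h_def m_def by auto
  ultimately show False using \<open>connected S\<close> unfolding connected_openin by metis
qed

section \<open>Weighted power means of two numbers\<close>

text \<open>The right side is the tangent at 1; this is Young's inequality with second number
  1.\<close>

lemma powr_tangent_concave:
  fixes r t :: real
  assumes "0 < r" "r < 1" "t \<ge> 0"
  shows "t powr r \<le> 1 + r * (t - 1)"
proof (cases "t = 0")
  case False
  then show ?thesis
    using Youngs_inequality_0[of r "1 - r" t 1] assms by (simp add: algebra_simps)
qed (use assms in simp)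

text \<open>With \<open>t powr r = exp (r * ln t)\<close>, two elementary bounds suffice:
  \<open>exp u \<ge> 1 + u\<close> and \<open>ln t \<le> t - 1\<close>, the latter reversed on
  multiplying by \<open>r < 0\<close>.\<close>

lemma powr_tangent_convex:
  fixes r t :: real
  assumes "r < 0" "t > 0"
  shows "t powr r \<ge> 1 + r * (t - 1)"
proof -
 have "1 + r * (t - 1) \<le> 1 + r * ln t" using assms ln_le_minus_one[of t] by (simp add: mult_left_mono_neg)
 also have "\<dots> \<le> t powr r" using assms exp_ge_add_one_self[of "r * ln t"] by (simp add: powr_def)
 finally show ?thesis .
qed

lemma affine_eq_0_iff:
  fixes s u v :: real
  assumes "0 < s" "s < 1" "u \<ge> 0" "v \<ge> 0"
  shows "s * u + (1 - s) * v = 0 \<longleftrightarrow> u = 0 \<and> v = 0"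
  using assms by (simp add: add_nonneg_eq_0_iff)

text \<open>Jensen's inequality. For \<open>r < 0\<close> the power is convex and the outer root is
  decreasing; for \<open>0 < r < 1\<close> it is concave and the root is increasing. Both reversals
  cancel, so the conclusion is the same.\<close>

lemma power_mean_le_affine:
  fixes s u v r :: real
  assumes s: "0 < s" "s < 1" and uv: "u \<ge> 0" "v \<ge> 0" and r: "r < 1" "r \<noteq> 0"
    and pos: "r < 0 \<Longrightarrow> u > 0 \<and> v > 0"
  shows "(s * u powr r + (1 - s) * v powr r) powr (1 / r) \<le> s * u + (1 - s) * v"
proof (cases "u = 0 \<and> v = 0")
  case False
  define w where "w = s * u + (1 - s) * v"
  define S where "S = s * u powr r + (1 - s) * v powr r"
  have "w > 0" 
  proof -
    have "w \<ge> 0" unfolding w_def using s uv by simp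
    moreover have "w \<noteq> 0" unfolding w_def using affine_eq_0_iff[OF s uv] False by simp
    ultimately show ?thesis by simp
  qed
  \<comment> \<open>The tangent of \<open>t powr r\<close> at the arithmetic mean \<open>w\<close>.
    Being affine, it averages to its value at \<open>w\<close>, which is
    \<open>w powr r\<close>.\<close>
  define g where "g t = w powr r * (1 + r * (t / w - 1))" for t
  have avg: "s * g u + (1 - s) * g v = w powr r"
  proof -
    have "s * g u + (1 - s) * g v = w powr r * (1 + r * ((s * u + (1 - s) * v) / w - 1))"
      unfolding g_def by (simp add: algebra_simps add_divide_distrib diff_divide_distrib)
    then show ?thesis using \<open>w > 0\<close> unfolding w_def by simp
  qed
  have scale: "t powr r = w powr r * (t / w) powr r" if "t \<ge> 0" for t
    using that \<open>w > 0\<close> by (simp add: powr_divide)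
  have root: "(w powr r) powr (1 / r) = w" using r \<open>w > 0\<close> by (simp add: powr_powr)
  show ?thesis
  proof (cases "r < 0")
    case True
    have "g t \<le> t powr r" if "t > 0" for t
      unfolding g_def using True \<open>w > 0\<close> that
      by (subst scale) (auto intro!: mult_left_mono powr_tangent_convex)
    then have "w powr r \<le> S"
      unfolding S_def avg[symmetric] using s True pos by (intro add_mono mult_left_mono) auto
    then have "S powr (1 / r) \<le> (w powr r) powr (1 / r)"
      using True \<open>w > 0\<close> by (intro powr_mono2') auto
    then show ?thesis using root unfolding S_def w_def by simp
  next
    case False
    have "t powr r \<le> g t" if "t \<ge> 0" for t
      unfolding g_def using False r \<open>w > 0\<close> that
      by (subst scale) (auto intro!: mult_left_mono powr_tangent_concave)
    then have "S \<le> w powr r"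
      unfolding S_def avg[symmetric] using s uv by (intro add_mono mult_left_mono) auto
    moreover have "S \<ge> 0" unfolding S_def using s by simp
    ultimately have "S powr (1 / r) \<le> (w powr r) powr (1 / r)"
      using False r by (intro powr_mono2) auto
    then show ?thesis using root unfolding S_def w_def by simp
  qed
qed simp

lemma power_mean_pair:
  "power_mean p (vector [a, b] :: real ^ 2) (vector [y, z]) =
    (if p = -\<infinity> then min y z
     else if p = 0 then y powr a * z powr b
     else if p < 0 \<and> (y = 0 \<or> z = 0) then 0
     else (a * y powr real_of_ereal p + b * z powr real_of_ereal p) powr (1 / real_of_ereal p))"
proof -
  have "(\<exists>i::2. P i) \<longleftrightarrow> P 1 \<or> P 2" for P by (metis exhaust_2)
  from this[of "\<lambda>i. (vector [y, z] :: real ^ 2) $ i = 0"]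
  have "(\<exists>i. (vector [y, z] :: real ^ 2) $ i = 0) \<longleftrightarrow> y = 0 \<or> z = 0" by simp
  then show ?thesis unfolding power_mean_def by (auto simp: UNIV_2)
qed

text \<open>Trades weights for scale factors: the mean of \<open>(y, z)\<close> with weights
  \<open>a\<close>, \<open>b\<close> is the mean with weights \<open>s\<close>, \<open>1 - s\<close>
  of the entries scaled by \<open>(a / s) powr (1 / r)\<close> and
  \<open>(b / (1 - s)) powr (1 / r)\<close>.\<close>

lemma weight_powr_scale:
  fixes a s r y :: real
  assumes "a > 0" "s > 0" "y \<ge> 0" "r \<noteq> 0"
  shows "s * ((a / s) powr (1 / r) * y) powr r = a * y powr r"
  using assms by (simp add: powr_mult powr_powr)

text \<open>Identifies the coefficient in (iii), where \<open>1 - \<rho>\<close> is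
  \<open>1 / q\<close>, as the new weight times the scale factor.\<close>

lemma powr_split_weight:
  fixes a s \<rho> :: real
  assumes "a > 0" "s > 0"
  shows "a powr \<rho> * s powr (1 - \<rho>) = s * (a / s) powr \<rho>"
  using assms by (simp add: powr_divide powr_diff)

lemma inverse_conj_exponent:
  assumes "p < 1" "p \<noteq> 0"
  shows "1 / conj_exponent p = 1 - recip_exponent p"
  using assms by (cases p) (auto simp: conj_exponent_def recip_exponent_def field_simps)

lemma recip_exponent_sign:
  assumes "p < 1" "p \<noteq> 0"
  shows "p < 0 \<longleftrightarrow> recip_exponent p \<le> 0" "p > 0 \<longleftrightarrow> recip_exponent p > 1"
    "p = -\<infinity> \<longleftrightarrow> recip_exponent p = 0"
proof -
  have "(p < 0 \<longleftrightarrow> recip_exponent p \<le> 0) \<and> (p > 0 \<longleftrightarrow> recip_exponent p > 1) \<and>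
    (p = -\<infinity> \<longleftrightarrow> recip_exponent p = 0)"
  proof (cases p)
    case (real r)
    then have "r < 1" "r \<noteq> 0" using assms by auto
    then show ?thesis using real
      by (auto simp: recip_exponent_def divide_le_0_iff less_divide_eq)
  qed (use assms in \<open>auto simp: recip_exponent_def\<close>)
  then show "p < 0 \<longleftrightarrow> recip_exponent p \<le> 0" "p > 0 \<longleftrightarrow> recip_exponent p > 1"
    "p = -\<infinity> \<longleftrightarrow> recip_exponent p = 0" by blast+
qed

text \<open>After the change of weights to \<open>s\<close> and \<open>1 - s\<close>, this compares
  a power mean of exponent below 1 with the arithmetic mean.\<close>

lemma power_mean_le_interior:
  fixes a b s y z :: real
  assumes "p < 1" "p \<noteq> 0" "a > 0" "b > 0" "0 < s" "s < 1" "y \<ge> 0" "z \<ge> 0"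
  defines "\<rho> \<equiv> recip_exponent p"
  shows "power_mean p (vector [a, b] :: real ^ 2) (vector [y, z])
    \<le> s * ((a / s) powr \<rho> * y) + (1 - s) * ((b / (1 - s)) powr \<rho> * z)"
proof (cases p)
  case (real r)
  then have r: "r < 1" "r \<noteq> 0" "\<rho> = 1 / r"
    using assms by (auto simp: \<rho>_def recip_exponent_def)
  show ?thesis
  proof (cases "p < 0 \<and> (y = 0 \<or> z = 0)")
    case True
    then show ?thesis using assms real by (auto simp: power_mean_pair)
  next
    case False
    have "power_mean p (vector [a, b] :: real ^ 2) (vector [y, z])
      = (s * ((a / s) powr \<rho> * y) powr r + (1 - s) * ((b / (1 - s)) powr \<rho> * z) powr r) powr (1 / r)"
      using False real r weight_powr_scale[OF \<open>a > 0\<close> \<open>0 < s\<close> \<open>y \<ge> 0\<close> r(2)]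
        weight_powr_scale[OF \<open>b > 0\<close> _ \<open>z \<ge> 0\<close> r(2), of "1 - s"] \<open>s < 1\<close>
      by (auto simp: power_mean_pair)
    also have "\<dots> \<le> s * ((a / s) powr \<rho> * y) + (1 - s) * ((b / (1 - s)) powr \<rho> * z)"
      using False assms r real by (intro power_mean_le_affine) auto
    finally show ?thesis .
  qed
next
  case MInf
  \<comment> \<open>Negated entries turn the upper bound for convex combinations into a lower
    bound.\<close>
  have "min y z \<le> s * y + (1 - s) * z"
    using convex_bound_le[of "- y" "- min y z" "- z" s "1 - s"] assms by simp
  then show ?thesis using MInf assms by (simp add: power_mean_pair \<rho>_def recip_exponent_def)
qed (use assms in auto)

text \<open>Once the scaled entries agree, the power mean and the arithmetic mean both equal their
  common value.\<close>

lemma power_mean_eq_balanced: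
  fixes a b s y z :: real
  assumes "p < 1" "p \<noteq> 0" "a > 0" "b > 0" "0 < s" "s < 1" "y \<ge> 0" "z \<ge> 0"
  defines "\<rho> \<equiv> recip_exponent p"
  assumes bal: "(a / s) powr \<rho> * y = (b / (1 - s)) powr \<rho> * z"
  shows "power_mean p (vector [a, b] :: real ^ 2) (vector [y, z])
    = s * ((a / s) powr \<rho> * y) + (1 - s) * ((b / (1 - s)) powr \<rho> * z)"
proof (cases p)
  case (real r)
  then have r: "r < 1" "r \<noteq> 0" "\<rho> = 1 / r"
    using assms by (auto simp: \<rho>_def recip_exponent_def)
  show ?thesis
  proof (cases "y = 0 \<or> z = 0")
    case True
    \<comment> \<open>The scale factors are positive, so one zero entry forces the other.\<close>
    then have "y = 0 \<and> z = 0" using bal assms by auto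
    then show ?thesis using assms real by (auto simp: power_mean_pair)
  next
    case False
    define k where "k = (a / s) powr \<rho> * y"
    have "k \<ge> 0" unfolding k_def using assms by simp
    have "power_mean p (vector [a, b] :: real ^ 2) (vector [y, z])
      = (s * ((a / s) powr \<rho> * y) powr r + (1 - s) * ((b / (1 - s)) powr \<rho> * z) powr r) powr (1 / r)"
      using False real r weight_powr_scale[OF \<open>a > 0\<close> \<open>0 < s\<close> \<open>y \<ge> 0\<close> r(2)]
        weight_powr_scale[OF \<open>b > 0\<close> _ \<open>z \<ge> 0\<close> r(2), of "1 - s"] \<open>s < 1\<close>
      by (auto simp: power_mean_pair)
    also have "\<dots> = (s * k powr r + (1 - s) * k powr r) powr (1 / r)"
      using bal k_def by simp
    also have "s * k powr r + (1 - s) * k powr r = k powr r" by (simp add: algebra_simps)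
    also have "(k powr r) powr (1 / r) = k" using r \<open>k \<ge> 0\<close> by (simp add: powr_powr)
    also have "k = s * k + (1 - s) * k" by (simp add: algebra_simps)
    finally show ?thesis using bal k_def by simp
  qed
next
  case MInf
  then show ?thesis using bal assms by (simp add: power_mean_pair \<rho>_def recip_exponent_def algebra_simps)
qed (use assms in auto)

text \<open>Serves the endpoints \<open>s = 0\<close> and \<open>s = 1\<close>, allowed when
  \<open>p < 0\<close>. Dropping a nonnegative summand lowers the base, which raises a power with
  negative exponent; a zero entry makes the mean zero by stipulation.\<close>

lemma power_mean_le_weight_powr:
  fixes a b y z :: real
  assumes "p < 0" "a > 0" "b > 0" "y \<ge> 0" "z \<ge> 0"
  shows "power_mean p (vector [a, b] :: real ^ 2) (vector [y, z]) \<le> a powr recip_exponent p * y"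
    and "power_mean p (vector [a, b] :: real ^ 2) (vector [y, z]) \<le> b powr recip_exponent p * z"
proof -
  have *: "(c * u powr r + d) powr (1 / r) \<le> c powr (1 / r) * u" 
    if "r < 0" "c > 0" "u > 0" "d \<ge> 0" for c d u r :: real
  proof -
    have "(c * u powr r + d) powr (1 / r) \<le> (c * u powr r) powr (1 / r)"
      using that by (intro powr_mono2') auto
    then show ?thesis using that by (simp add: powr_mult powr_powr)
  qed
  show "power_mean p (vector [a, b] :: real ^ 2) (vector [y, z]) \<le> a powr recip_exponent p * y"
  proof (cases p)
    case (real r)
    then show ?thesis using assms *[of r a y "b * z powr r"]
      by (auto simp: power_mean_pair recip_exponent_def)
  qed (use assms in \<open>auto simp: power_mean_pair recip_exponent_def\<close>)
  show "power_mean p (vector [a, b] :: real ^ 2) (vector [y, z]) \<le> b powr recip_exponent p * z"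
  proof (cases p)
    case (real r)
    then show ?thesis using assms *[of r b z "a * y powr r"]
      by (auto simp: power_mean_pair recip_exponent_def add.commute)
  qed (use assms in \<open>auto simp: power_mean_pair recip_exponent_def\<close>)
qed

section \<open>Behaviour near the ends of the parameter interval\<close>

text \<open>As \<open>s\<close> tends to 0 from the right, \<open>s * (a / s) powr \<rho>\<close>
  and \<open>(a / s) powr \<rho>\<close> both blow up, while the coefficients of \<open>z\<close>
  stay bounded.\<close>

lemma endpoint_unbalanced_above_one:
  fixes a b \<rho> y z c :: real
  assumes "a > 0" "b > 0" "\<rho> > 1" "y > 0"
  shows "\<exists>s\<in>{0<..<1}. s * ((a / s) powr \<rho> * y) + (1 - s) * ((b / (1 - s)) powr \<rho> * z) > c
    \<and> (a / s) powr \<rho> * y > (b / (1 - s)) powr \<rho> * z"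
proof -
  have "eventually (\<lambda>s. s * ((a / s) powr \<rho> * y) + (1 - s) * ((b / (1 - s)) powr \<rho> * z) > c) (at_right 0)"
    "eventually (\<lambda>s. (a / s) powr \<rho> * y > (b / (1 - s)) powr \<rho> * z) (at_right 0)"
    using assms by real_asymp+
  moreover have "eventually (\<lambda>s::real. s \<in> {0<..<1}) (at_right 0)"
    using eventually_at_right_real[of 0 1] by simp
  ultimately have "eventually (\<lambda>s. s \<in> {0<..<1} \<and>
    s * ((a / s) powr \<rho> * y) + (1 - s) * ((b / (1 - s)) powr \<rho> * z) > c
    \<and> (a / s) powr \<rho> * y > (b / (1 - s)) powr \<rho> * z) (at_right 0)"
    by eventually_elim auto
  from eventually_happens'[OF _ this] show ?thesis by auto
qed

text \<open>As \<open>s\<close> tends to 0 from the right, the linear form tends to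
  \<open>b powr \<rho> * z\<close>, which exceeds \<open>c\<close>. For \<open>\<rho> < 0\<close>
  the factor \<open>(a / s) powr \<rho>\<close> tends to 0, which settles the comparison; for
  \<open>\<rho> = 0\<close> both scale factors are 1 and \<open>y < z\<close> is what
  remains.\<close>

lemma endpoint_unbalanced_nonpos:
  fixes a b \<rho> y z c :: real
  assumes "a > 0" "b > 0" "\<rho> \<le> 0" "z > 0" "b powr \<rho> * z > c" "\<rho> = 0 \<Longrightarrow> y < z"
  shows "\<exists>s\<in>{0<..<1}. s * ((a / s) powr \<rho> * y) + (1 - s) * ((b / (1 - s)) powr \<rho> * z) > c
    \<and> (a / s) powr \<rho> * y < (b / (1 - s)) powr \<rho> * z"
proof -
  have in01: "eventually (\<lambda>s::real. s \<in> {0<..<1}) (at_right 0)"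
    using eventually_at_right_real[of 0 1] by simp
  have "eventually (\<lambda>s. s * ((a / s) powr \<rho> * y) + (1 - s) * ((b / (1 - s)) powr \<rho> * z) > c) (at_right 0)
    \<and> eventually (\<lambda>s. (a / s) powr \<rho> * y < (b / (1 - s)) powr \<rho> * z) (at_right 0)"
  proof (cases "\<rho> = 0")
    case False
    with assms have "\<rho> < 0" by simp
    with assms show ?thesis by (intro conjI; real_asymp)
  next
    case True
    have "z > c" using assms True by simp
    then have "eventually (\<lambda>s. s * y + (1 - s) * z > c) (at_right 0)" by real_asymp
    with in01 have "eventually (\<lambda>s. s * ((a / s) powr \<rho> * y)
        + (1 - s) * ((b / (1 - s)) powr \<rho> * z) > c) (at_right 0)"
      by eventually_elim (use assms True in simp)
    moreover from in01 have "eventually (\<lambda>s. (a / s) powr \<rho> * y < (b / (1 - s)) powr \<rho> * z) (at_right 0)"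
      by eventually_elim (use assms True in simp)
    ultimately show ?thesis by blast
  qed
  with in01 have "eventually (\<lambda>s. s \<in> {0<..<1} \<and>
    s * ((a / s) powr \<rho> * y) + (1 - s) * ((b / (1 - s)) powr \<rho> * z) > c
    \<and> (a / s) powr \<rho> * y < (b / (1 - s)) powr \<rho> * z) (at_right 0)"
    by (auto simp: eventually_conj_iff)
  from eventually_happens'[OF _ this] show ?thesis by auto
qed

section \<open>The equivalences for nonzero and for zero exponent\<close>

lemma power_mean_le_iff_loewner_nonzero:
  fixes A B C :: "real ^ 'n ^ 'n" and a b :: real and p :: ereal
  assumes "psd A" "psd B" "psd C" "A \<noteq> 0" "B \<noteq> 0" "a > 0" "b > 0" "p < 1" "p \<noteq> 0"
  defines "\<rho> \<equiv> recip_exponent p"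
  shows "(\<forall>x. power_mean p (vector [a, b] :: real ^ 2) (vector [x \<bullet> (A *v x), x \<bullet> (B *v x)])
        \<le> x \<bullet> (C *v x)) \<longleftrightarrow>
    (\<exists>s\<in>param_set p. (a powr \<rho> * s powr (1 - \<rho>)) *\<^sub>R A
      + (b powr \<rho> * (1 - s) powr (1 - \<rho>)) *\<^sub>R B \<preceq>\<^sub>L C)"
  (is "?mean \<longleftrightarrow> ?lin")
proof -
  note sign = recip_exponent_sign[OF \<open>p < 1\<close> \<open>p \<noteq> 0\<close>, folded \<rho>_def]
  have nonneg: "x \<bullet> (A *v x) \<ge> 0" "x \<bullet> (B *v x) \<ge> 0" "x \<bullet> (C *v x) \<ge> 0" for x
    using assms by (auto simp: psd_def)
  define h where "h s x = (a powr \<rho> * s powr (1 - \<rho>)) * (x \<bullet> (A *v x))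
      + (b powr \<rho> * (1 - s) powr (1 - \<rho>)) * (x \<bullet> (B *v x))" for s x
  have lin: "?lin \<longleftrightarrow> (\<exists>s\<in>param_set p. \<forall>x. h s x \<le> x \<bullet> (C *v x))"
    unfolding h_def using loewner_le_lincomb_iff[OF assms(1-3)] by simp
  have h_interior: "h s x = s * ((a / s) powr \<rho> * (x \<bullet> (A *v x)))
      + (1 - s) * ((b / (1 - s)) powr \<rho> * (x \<bullet> (B *v x)))" if "s \<in> {0<..<1}" for s x
    using that assms powr_split_weight[of a s \<rho>] powr_split_weight[of b "1 - s" \<rho>]
    by (simp add: h_def mult.assoc)
  have "?mean" if "s \<in> param_set p" "\<forall>x. h s x \<le> x \<bullet> (C *v x)" for s
  proof
    fix x
    have "power_mean p (vector [a, b] :: real ^ 2) (vector [x \<bullet> (A *v x), x \<bullet> (B *v x)]) \<le> h s x"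
    proof (cases "s \<in> {0<..<1}")
      case True
      then show ?thesis
        using power_mean_le_interior[of p a b s] assms nonneg unfolding h_interior[OF True] \<rho>_def by simp
    next
      case False
      \<comment> \<open>Here \<open>1 - \<rho> > 0\<close>, and
        \<open>0 powr (1 - \<rho>) = 0\<close> removes one of the two matrices from
        \<open>h\<close>.\<close>
      with that have "p < 0" "s = 0 \<or> s = 1" by (auto simp: param_set_def split: if_splits)
      then show ?thesis
        using power_mean_le_weight_powr[of p a b] assms nonneg unfolding h_def \<rho>_def by auto
    qed
    then show "power_mean p (vector [a, b] :: real ^ 2) (vector [x \<bullet> (A *v x), x \<bullet> (B *v x)])
        \<le> x \<bullet> (C *v x)" using that by (meson order_trans)
  qed
  moreover have "\<exists>s\<in>param_set p. \<forall>x. h s x \<le> x \<bullet> (C *v x)" if mean: "?mean"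
  proof (rule ccontr)
    assume none: "\<not> ?thesis"
    define \<mu> where "\<mu> s = (a / s) powr \<rho>" for s
    define \<nu> where "\<nu> s = (b / (1 - s)) powr \<rho>" for s
    have h_eq: "h s x = (s * \<mu> s) * (x \<bullet> (A *v x)) + ((1 - s) * \<nu> s) * (x \<bullet> (B *v x))"
      if "s \<in> {0<..<1}" for s x
      using h_interior[OF that] by (simp add: \<mu>_def \<nu>_def)
    have ends: "(\<exists>s\<in>{0<..<1}. \<exists>x. h s x > x \<bullet> (C *v x) \<and> \<mu> s * (x \<bullet> (A *v x)) > \<nu> s * (x \<bullet> (B *v x)))
      \<and> (\<exists>s\<in>{0<..<1}. \<exists>x. h s x > x \<bullet> (C *v x) \<and> \<mu> s * (x \<bullet> (A *v x)) < \<nu> s * (x \<bullet> (B *v x)))"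
    proof (cases "p < 0")
      case True
      then have \<rho>: "\<rho> \<le> 0" "0 \<in> param_set p" "1 \<in> param_set p"
        using sign by (auto simp: param_set_def)
      \<comment> \<open>For \<open>p < 0\<close> the endpoints are themselves admissible parameters,
        so their failure supplies the vectors used near each end.\<close>
      with none obtain x0 x1 where "h 0 x0 > x0 \<bullet> (C *v x0)" "h 1 x1 > x1 \<bullet> (C *v x1)"
        by (meson not_le)
      then have x0: "b powr \<rho> * (x0 \<bullet> (B *v x0)) > x0 \<bullet> (C *v x0)"
        and x1: "a powr \<rho> * (x1 \<bullet> (A *v x1)) > x1 \<bullet> (C *v x1)" by (simp_all add: h_def)
      then have pos: "x0 \<bullet> (B *v x0) > 0" "x1 \<bullet> (A *v x1) > 0"
        using nonneg by (metis less_eq_real_def mult_zero_right not_le)+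
      \<comment> \<open>If \<open>\<rho> = 0\<close>, the mean is the minimum. By (i) it is at most
        the value of \<open>C\<close>, which lies below that of \<open>B\<close> at
        \<open>x0\<close> and of \<open>A\<close> at \<open>x1\<close>; so the other matrix attains
        it strictly.\<close>
      have "x0 \<bullet> (A *v x0) < x0 \<bullet> (B *v x0)" "x1 \<bullet> (B *v x1) < x1 \<bullet> (A *v x1)" if "\<rho> = 0"
        using mean[rule_format, of x0] mean[rule_format, of x1] x0 x1 that sign(3) assms
        by (auto simp: power_mean_pair min_def split: if_splits)
      with endpoint_unbalanced_nonpos[of a b \<rho>, OF _ _ _ pos(1) x0]
        endpoint_unbalanced_nonpos[of b a \<rho>, OF _ _ _ pos(2) x1] assms \<rho>
      obtain s t where s: "s \<in> {0<..<1}"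
          "s * ((a / s) powr \<rho> * (x0 \<bullet> (A *v x0))) + (1 - s) * ((b / (1 - s)) powr \<rho> * (x0 \<bullet> (B *v x0)))
            > x0 \<bullet> (C *v x0)"
          "(a / s) powr \<rho> * (x0 \<bullet> (A *v x0)) < (b / (1 - s)) powr \<rho> * (x0 \<bullet> (B *v x0))"
        and t: "t \<in> {0<..<1}"
          "t * ((b / t) powr \<rho> * (x1 \<bullet> (B *v x1))) + (1 - t) * ((a / (1 - t)) powr \<rho> * (x1 \<bullet> (A *v x1)))
            > x1 \<bullet> (C *v x1)"
          "(b / t) powr \<rho> * (x1 \<bullet> (B *v x1)) < (a / (1 - t)) powr \<rho> * (x1 \<bullet> (A *v x1))"
        by metis
      show ?thesis
      proof
        show "\<exists>s\<in>{0<..<1}. \<exists>x. h s x > x \<bullet> (C *v x) \<and> \<mu> s * (x \<bullet> (A *v x)) < \<nu> s * (x \<bullet> (B *v x))"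
          using s h_interior[OF s(1), of x0] unfolding \<mu>_def \<nu>_def by metis
        show "\<exists>s\<in>{0<..<1}. \<exists>x. h s x > x \<bullet> (C *v x) \<and> \<mu> s * (x \<bullet> (A *v x)) > \<nu> s * (x \<bullet> (B *v x))"
          \<comment> \<open>The end \<open>s = 1\<close> is the end \<open>t = 0\<close> with
            \<open>a\<close>, \<open>A\<close> and \<open>b\<close>, \<open>B\<close> exchanged and
            \<open>s = 1 - t\<close>.\<close>
          using t h_interior[of "1 - t" x1] unfolding \<mu>_def \<nu>_def
          by (intro bexI[of _ "1 - t"] exI[of _ x1]) (auto simp: add.commute)
      qed
    next
      case False
      then have "\<rho> > 1" using sign assms by auto
      \<comment> \<open>For \<open>0 < p < 1\<close> the coefficients blow up at the ends, so any
        vector with a positive value will do; this is where \<open>A\<close> and \<open>B\<close>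
        being nonzero enters.\<close>
      obtain x0 x1 where "x0 \<bullet> (A *v x0) > 0" "x1 \<bullet> (B *v x1) > 0"
        using psd_nonzero_pos assms by metis
      with endpoint_unbalanced_above_one[of a b \<rho>] endpoint_unbalanced_above_one[of b a \<rho>] assms \<open>\<rho> > 1\<close>
      obtain s t where s: "s \<in> {0<..<1}"
          "s * ((a / s) powr \<rho> * (x0 \<bullet> (A *v x0))) + (1 - s) * ((b / (1 - s)) powr \<rho> * (x0 \<bullet> (B *v x0)))
            > x0 \<bullet> (C *v x0)"
          "(a / s) powr \<rho> * (x0 \<bullet> (A *v x0)) > (b / (1 - s)) powr \<rho> * (x0 \<bullet> (B *v x0))"
        and t: "t \<in> {0<..<1}"
          "t * ((b / t) powr \<rho> * (x1 \<bullet> (B *v x1))) + (1 - t) * ((a / (1 - t)) powr \<rho> * (x1 \<bullet> (A *v x1)))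
            > x1 \<bullet> (C *v x1)"
          "(b / t) powr \<rho> * (x1 \<bullet> (B *v x1)) > (a / (1 - t)) powr \<rho> * (x1 \<bullet> (A *v x1))"
        by metis
      show ?thesis
      proof
        show "\<exists>s\<in>{0<..<1}. \<exists>x. h s x > x \<bullet> (C *v x) \<and> \<mu> s * (x \<bullet> (A *v x)) > \<nu> s * (x \<bullet> (B *v x))"
          using s h_interior[OF s(1), of x0] unfolding \<mu>_def \<nu>_def by metis
        show "\<exists>s\<in>{0<..<1}. \<exists>x. h s x > x \<bullet> (C *v x) \<and> \<mu> s * (x \<bullet> (A *v x)) < \<nu> s * (x \<bullet> (B *v x))"
          using t h_interior[of "1 - t" x1] unfolding \<mu>_def \<nu>_def
          by (intro bexI[of _ "1 - t"] exI[of _ x1]) (auto simp: add.commute)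
      qed
    qed
    \<comment> \<open>Only the open interval is used, where the scale factors are continuous and
      balance gives equality with the mean.\<close>
    have "\<exists>s\<in>{0<..<1}. \<forall>x. (s * \<mu> s) * (x \<bullet> (A *v x)) + ((1 - s) * \<nu> s) * (x \<bullet> (B *v x))
      \<le> x \<bullet> (C *v x)"
    proof (rule exists_dominating_parameter)
      show "connected {0::real<..<1}" by simp
      have \<mu>: "continuous_on {0<..<1} \<mu>" unfolding \<mu>_def using assms by (intro continuous_intros) auto
      have \<nu>: "continuous_on {0<..<1} \<nu>" unfolding \<nu>_def using assms by (intro continuous_intros) auto
      show "continuous_on {0<..<1} \<mu>" "continuous_on {0<..<1} \<nu>" by fact+
      show "continuous_on {0<..<1} (\<lambda>s. s * \<mu> s)" "continuous_on {0<..<1} (\<lambda>s. (1 - s) * \<nu> s)"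
        by (intro continuous_intros \<mu> \<nu>)+
      fix s x assume s: "s \<in> {0::real<..<1}" and bal: "\<mu> s * (x \<bullet> (A *v x)) = \<nu> s * (x \<bullet> (B *v x))"
      have "power_mean p (vector [a, b] :: real ^ 2) (vector [x \<bullet> (A *v x), x \<bullet> (B *v x)])
        = (s * \<mu> s) * (x \<bullet> (A *v x)) + ((1 - s) * \<nu> s) * (x \<bullet> (B *v x))"
        using power_mean_eq_balanced[of p a b s "x \<bullet> (A *v x)" "x \<bullet> (B *v x)"] s bal assms nonneg
        unfolding \<mu>_def \<nu>_def \<rho>_def by (simp add: mult.assoc)
      then show "(s * \<mu> s) * (x \<bullet> (A *v x)) + ((1 - s) * \<nu> s) * (x \<bullet> (B *v x)) \<le> x \<bullet> (C *v x)"
        using mean by metis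
    qed (use ends h_eq in metis)+
    then obtain s where "s \<in> {0<..<1}" "\<forall>x. h s x \<le> x \<bullet> (C *v x)" using h_eq by metis
    moreover from this have "s \<in> param_set p" by (auto simp: param_set_def)
    ultimately show False using none by blast
  qed
  ultimately show ?thesis unfolding lin by blast
qed

text \<open>The factors \<open>s powr b\<close> and \<open>s powr (- a)\<close> leave the geometric
  mean with weights \<open>a\<close>, \<open>b\<close> unchanged, so weighted AM-GM for the scaled
  entries gives (i) from (ii), with equality when they agree.\<close>

lemma power_mean_le_iff_loewner_zero:
  fixes A B C :: "real ^ 'n ^ 'n" and a b :: real
  assumes "psd A" "psd B" "psd C" "A \<noteq> 0" "B \<noteq> 0" "a > 0" "b > 0" "a + b = 1"
  shows "(\<forall>x. power_mean 0 (vector [a, b] :: real ^ 2) (vector [x \<bullet> (A *v x), x \<bullet> (B *v x)])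
        \<le> x \<bullet> (C *v x)) \<longleftrightarrow>
    (\<exists>s>0. (a * s powr b) *\<^sub>R A + (b * s powr (- a)) *\<^sub>R B \<preceq>\<^sub>L C)"
  (is "?mean \<longleftrightarrow> ?lin")
proof -
  have nonneg: "x \<bullet> (A *v x) \<ge> 0" "x \<bullet> (B *v x) \<ge> 0" for x
    using assms by (auto simp: psd_def)
  have lin: "?lin \<longleftrightarrow> (\<exists>s\<in>{0<..}. \<forall>x. (a * s powr b) * (x \<bullet> (A *v x))
      + (b * s powr (- a)) * (x \<bullet> (B *v x)) \<le> x \<bullet> (C *v x))"
    using loewner_le_lincomb_iff[OF assms(1-3)] by auto
  have scale: "(s powr b * y) powr a * (s powr (- a) * z) powr b = y powr a * z powr b"
    if "s > 0" "y \<ge> 0" "z \<ge> 0" for s y z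
  proof -
    have "(s powr b) powr a * (s powr (- a)) powr b = 1"
      using that by (simp add: powr_powr flip: powr_add)
    then show ?thesis using that by (simp add: powr_mult)
  qed
  have amgm: "y powr a * z powr b \<le> (a * s powr b) * y + (b * s powr (- a)) * z"
    if "s > 0" "y \<ge> 0" "z \<ge> 0" for s y z
  \<comment> \<open>Young's inequality is applied to positive numbers; if an entry is zero, the left
    side vanishes because \<open>0 powr r = 0\<close>.\<close>
  proof (cases "y = 0 \<or> z = 0")
    case False
    then show ?thesis
      using Youngs_inequality_0[of a b "s powr b * y" "s powr (- a) * z"] assms that scale[OF that]
      by (simp add: mult.assoc)
  qed (use that assms in auto)
  have "?mean" if "s \<in> {0<..}" "\<forall>x. (a * s powr b) * (x \<bullet> (A *v x))
      + (b * s powr (- a)) * (x \<bullet> (B *v x)) \<le> x \<bullet> (C *v x)" for s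
    using that amgm[of s, OF _ nonneg] by (auto simp: power_mean_pair intro: order_trans)
  moreover have "\<exists>s\<in>{0<..}. \<forall>x. (a * s powr b) * (x \<bullet> (A *v x))
      + (b * s powr (- a)) * (x \<bullet> (B *v x)) \<le> x \<bullet> (C *v x)" if mean: "?mean"
  proof (rule exists_dominating_parameter)
    show "connected {0::real<..}" by simp
    show "continuous_on {0<..} (\<lambda>s. a * s powr b)" "continuous_on {0<..} (\<lambda>s. b * s powr (- a))"
      "continuous_on {0<..} (\<lambda>s::real. s powr b)" "continuous_on {0<..} (\<lambda>s::real. s powr (- a))"
      by (intro continuous_intros; force)+
    obtain x0 x1 where x: "x0 \<bullet> (A *v x0) > 0" "x1 \<bullet> (B *v x1) > 0"
      using psd_nonzero_pos assms by metis
    have "\<exists>s\<in>{0<..}. (a * s powr b) * y + (b * s powr (- a)) * z > c \<and> s powr b * y > s powr (- a) * z"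
      if "y > 0" for y z c
    proof -
      \<comment> \<open>Large \<open>s\<close> makes the term of \<open>y\<close> dominate; below,
        small \<open>s\<close> does the same for \<open>z\<close>.\<close>
      have "eventually (\<lambda>s. (a * s powr b) * y + (b * s powr (- a)) * z > c) at_top"
        "eventually (\<lambda>s. s powr b * y > s powr (- a) * z) at_top"
        "eventually (\<lambda>s::real. s > 0) at_top"
        using assms(6,7) that by real_asymp+
      then have "eventually (\<lambda>s. s > 0 \<and> (a * s powr b) * y + (b * s powr (- a)) * z > c
        \<and> s powr b * y > s powr (- a) * z) at_top"
        by eventually_elim auto
      from eventually_happens'[OF _ this] show ?thesis by auto
    qed
    from this[OF x(1)] show "\<exists>s\<in>{0<..}. \<exists>x. (a * s powr b) * (x \<bullet> (A *v x))
      + (b * s powr (- a)) * (x \<bullet> (B *v x)) > x \<bullet> (C *v x)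
      \<and> s powr b * (x \<bullet> (A *v x)) > s powr (- a) * (x \<bullet> (B *v x))" by blast
    have "\<exists>s\<in>{0<..}. (a * s powr b) * y + (b * s powr (- a)) * z > c \<and> s powr b * y < s powr (- a) * z"
      if "z > 0" for y z c
    proof -
      have "eventually (\<lambda>s. (a * s powr b) * y + (b * s powr (- a)) * z > c) (at_right 0)"
        "eventually (\<lambda>s. s powr b * y < s powr (- a) * z) (at_right 0)"
        "eventually (\<lambda>s::real. s > 0) (at_right 0)"
        using assms(6,7) that by real_asymp+
      then have "eventually (\<lambda>s. s > 0 \<and> (a * s powr b) * y + (b * s powr (- a)) * z > c
        \<and> s powr b * y < s powr (- a) * z) (at_right 0)"
        by eventually_elim auto
      from eventually_happens'[OF _ this] show ?thesis by auto
    qed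
    from this[OF x(2)] show "\<exists>s\<in>{0<..}. \<exists>x. (a * s powr b) * (x \<bullet> (A *v x))
      + (b * s powr (- a)) * (x \<bullet> (B *v x)) > x \<bullet> (C *v x)
      \<and> s powr b * (x \<bullet> (A *v x)) < s powr (- a) * (x \<bullet> (B *v x))" by blast
    fix s x assume s: "s \<in> {0<..}"
      and bal: "s powr b * (x \<bullet> (A *v x)) = s powr (- a) * (x \<bullet> (B *v x))"
    \<comment> \<open>The common scaled value; since \<open>a + b = 1\<close>, both the linear form
      and the geometric mean equal \<open>k\<close>.\<close>
    define k where "k = s powr b * (x \<bullet> (A *v x))"
    have "k \<ge> 0" unfolding k_def using nonneg by simp
    have "(a * s powr b) * (x \<bullet> (A *v x)) + (b * s powr (- a)) * (x \<bullet> (B *v x)) = (a + b) * k"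
      unfolding distrib_right using bal by (simp add: k_def mult.assoc)
    also have "\<dots> = k powr a * k powr b"
      using assms(8) \<open>k \<ge> 0\<close> by (simp flip: powr_add)
    also have "\<dots> = (x \<bullet> (A *v x)) powr a * (x \<bullet> (B *v x)) powr b"
      using scale[of s, OF _ nonneg(1) nonneg(2), of x x] s bal by (simp add: k_def)
    also have "\<dots> \<le> x \<bullet> (C *v x)"
      using mean by (simp add: power_mean_pair)
    finally show "(a * s powr b) * (x \<bullet> (A *v x)) + (b * s powr (- a)) * (x \<bullet> (B *v x))
      \<le> x \<bullet> (C *v x)" .
  qed
  ultimately show ?thesis unfolding lin by blast
qed

theorem corollary4p1:
  fixes A B C :: "real ^ 'n ^ 'n" and a b q :: real and p :: ereal
  assumes "psd A" and "psd B" and "psd C"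
    and "A \<noteq> 0" and "B \<noteq> 0"
    and "a > 0" and "b > 0" and "a + b = 1"
    and "p < 1"
    and "q = conj_exponent p"
  defines "stmt_i \<equiv> (\<forall>x :: real ^ 'n.
      power_mean p (vector [a, b] :: real ^ 2) (vector [x \<bullet> (A *v x), x \<bullet> (B *v x)])
        \<le> x \<bullet> (C *v x))"
    and "stmt_ii \<equiv> (\<exists>s :: real. s > 0 \<and>
      (a * s powr b) *\<^sub>R A + (b * s powr (- a)) *\<^sub>R B \<preceq>\<^sub>L C)"
    and "stmt_iii \<equiv> (\<exists>s \<in> param_set p.
      (a powr recip_exponent p * s powr (1 / q)) *\<^sub>R A
        + (b powr recip_exponent p * (1 - s) powr (1 / q)) *\<^sub>R B \<preceq>\<^sub>L C)"
  shows "(p = 0 \<longrightarrow> (stmt_i \<longleftrightarrow> stmt_ii)) \<and> (p \<noteq> 0 \<longrightarrow> (stmt_i \<longleftrightarrow> stmt_iii))"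
proof (intro conjI impI)
  show "stmt_i \<longleftrightarrow> stmt_ii" if "p = 0"
    unfolding stmt_i_def stmt_ii_def that by (rule power_mean_le_iff_loewner_zero[OF assms(1-8)])
  show "stmt_i \<longleftrightarrow> stmt_iii" if "p \<noteq> 0"
    \<comment> \<open>The exponent \<open>1 / q\<close> becomes \<open>1 - recip_exponent p\<close>,
      also at \<open>p = -\<infinity>\<close>.\<close>
    unfolding stmt_i_def stmt_iii_def assms(10) inverse_conj_exponent[OF assms(9) that]
    by (rule power_mean_le_iff_loewner_nonzero[OF assms(1-7,9) that])
qed

end
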